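(* Let $\theta>0$. For each $n\in\mathbb N$ let $X_n:\mathcal P_n\to(\mathcal X,\|\cdot\|)$ be a deterministic function on the set $\mathcal P_n$ of partitions of $n$, taking values in a fixed normed space. Via the Feller coupling, regard $X_n$ as a function $X_n(\xi_1,\ldots,\xi_n)$ of binary strings $(\xi_1,\dots,\xi_n)\in\{0,1\}^n$ with $\xi_1=1$. Suppose that for every fixed $d\in\mathbb N$, $$\lim_{n\to\infty}\ \max_{\xi_1,\ldots,\xi_n}\Big\|X_n(\xi_1,\ldots,\xi_n)-X_n(1,\ldots,1,\xi_{d+1},\ldots,\xi_n)\Big\|=0,$$ where the maximum is over all $(\xi_1,\ldots,\xi_n)\in\{0,1\}^n$ with $\xi_1=1$, and in the second term the first $d$ entries are replaced by $1$. If $X_n$ converges in distribution to a random element $X$ of $\mathcal X$ when, for each $n$, the partition of $n$ is distributed according to the Ewens measure $\mathbb P^\theta_n$, then $X_n$ converges in distribution to the same $X$ when, for each $n$, the partition of $n$ is distributed according to $\mathbb P_n$, for any sequence $(\mathbb P_n)_{n\in\mathbb N}$ of asymptotically Ewens measures with parameter $\theta$.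
   Context: Partitions. $\mathcal P_n$ is the set of partitions of $n$, written $\alpha=(\alpha_1,\ldots,\alpha_n)$, where $\alpha_i\ge0$ is the number of parts of size $i$, so $\alpha_1+2\alpha_2+\cdots+n\alpha_n=n$. A vector $(\alpha_1,\ldots,\alpha_m)$ of nonnegative integers is regarded as a partition of $k=\sum_{i\le m} i\alpha_i$ (discarding or appending zeros as needed; $k=0$ gives the empty partition). Ewens measure. For $\theta>0$, $\mathbb P^\theta_n(\alpha)=\frac{n!}{\theta(\theta+1)\cdots(\theta+n-1)}\prod_{i=1}^n\frac{\theta^{\alpha_i}}{i^{\alpha_i}\alpha_i!}$ for $\alpha\in\mathcal P_n$. Perturbed measures. Given a nonnegative function $\eta$ on the set of all partitions of all integers $k\ge0$, let $\mathbb P^{\theta,\eta}_n(\alpha)=\frac{\eta(\alpha)}{Z^{\theta,\eta}_n}\prod_{i=1}^n\frac{\theta^{\alpha_i}}{i^{\alpha_i}\alpha_i!}$ for $\alpha\in\mathcal P_n$, where $Z_n^{\theta,\eta}$ is the normalising constant (assumed positive for every $n\in\mathbb N$). Thus $\eta$ restricted to $\mathcal P_n$ is a positive constant multiple of the Radon-Nikodym derivative of $\mathbb P^{\theta,\eta}_n$ with respect to $\mathbb P^\theta_n$. Feller coupling. For a binary sequence $\xi=(\xi_1,\xi_2,\ldots)\in\{0,1\}^{\mathbb N}$ with $\xi_1=1$ and $n\in\mathbb N$, define the partition $(\alpha_1(n),\ldots,\alpha_n(n))\in\mathcal P_n$ by $$\alpha_i(n)=\sum_{j=1}^{n-i}\xi_j(1-\xi_{j+1})\cdots(1-\xi_{j+i-1})\xi_{i+j}+\xi_{n-i+1}(1-\xi_{n-i+2})\cdots(1-\xi_n),$$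 i.e. the number of maximal runs of exactly $i-1$ zeros between consecutive $1$s in the string $(\xi_1,\ldots,\xi_n,1)$. It depends only on $\xi_1,\dots,\xi_n$. Let $\mathbb P^\theta_F$ be the probability measure on $\{0,1\}^{\mathbb N}$ under which the $\xi_i$ are independent Bernoulli with success probability $\theta/(\theta+i-1)$ (so $\xi_1=1$ almost surely); the law of $(\alpha_1(n),\dots,\alpha_n(n))$ under $\mathbb P_F^\theta$ is $\mathbb P^\theta_n$. Expectation under $\mathbb P^\theta_F$ is $\mathbb E^\theta_F$. Asymptotically Ewens. Given a nonnegative function $\eta$ on the set of all partitions of all integers $k\ge0$, for $m\le n$ define the random variables (under $\mathbb P^\theta_F$) $\eta_{n,m}=\eta(\alpha_1(n),\ldots,\alpha_m(n))$. A sequence of measures $\mathbb P_n$ on $\mathcal P_n$, $n\in\mathbb N$, is asymptotically Ewens with parameter $\theta$ if it can be written as $\mathbb P_n=\mathbb P_n^{\theta,\eta}$ for some nonnegative function $\eta$ on the set of all partitions of all integers $k\ge0$, with $Z_n^{\theta,\eta}>0$ for every $n\in\mathbb N$, such that (1) the limits $\lim_{n\to\infty}\eta_{n,n}$ and $\lim_{m\to\infty}\lim_{n\to\infty}\eta_{n,m}$ exist and agree in $L^1(\mathbb P^\theta_F)$; and (2) the common limit $\eta_\infty$ satisfies $0<\mathbb E^\theta_F[\eta_\infty]<\infty$. *)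

theory Defs
  imports "HOL-Probability.Probability"
begin

text \<open>
  A partition of \<open>n\<close> is given by its multiplicities: \<open>\<alpha> i\<close> is the number of parts of size \<open>i\<close>,
  and \<open>\<alpha>\<close> vanishes outside \<open>{1..n}\<close>. Appending or discarding zeros therefore does not change the
  function, so partitions of different integers share one type without ambiguity.
\<close>

definition partitions :: "nat \<Rightarrow> (nat \<Rightarrow> nat) set" where
  "partitions n = {\<alpha>. (\<forall>i. i \<notin> {1..n} \<longrightarrow> \<alpha> i = 0) \<and> (\<Sum>i=1..n. i * \<alpha> i) = n}"

definition ewens_weight :: "real \<Rightarrow> nat \<Rightarrow> (nat \<Rightarrow> nat) \<Rightarrow> real" where
  "ewens_weight \<theta> n \<alpha> = (\<Prod>i=1..n. \<theta> ^ \<alpha> i / (real i ^ \<alpha> i * fact (\<alpha> i)))"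

definition ewens :: "real \<Rightarrow> nat \<Rightarrow> (nat \<Rightarrow> nat) measure" where
  "ewens \<theta> n = point_measure (partitions n)
     (\<lambda>\<alpha>. ennreal (fact n / pochhammer \<theta> n * ewens_weight \<theta> n \<alpha>))"

definition ewens_norm :: "real \<Rightarrow> ((nat \<Rightarrow> nat) \<Rightarrow> real) \<Rightarrow> nat \<Rightarrow> real" where
  "ewens_norm \<theta> \<eta> n = (\<Sum>\<alpha>\<in>partitions n. \<eta> \<alpha> * ewens_weight \<theta> n \<alpha>)"

definition perturbed_ewens ::
  "real \<Rightarrow> ((nat \<Rightarrow> nat) \<Rightarrow> real) \<Rightarrow> nat \<Rightarrow> (nat \<Rightarrow> nat) measure" where
  "perturbed_ewens \<theta> \<eta> n = point_measure (partitions n)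
     (\<lambda>\<alpha>. ennreal (\<eta> \<alpha> / ewens_norm \<theta> \<eta> n * ewens_weight \<theta> n \<alpha>))"

text \<open>
  Binary sequences are functions \<open>\<xi> :: nat \<Rightarrow> bool\<close>, read at the indices \<open>1, 2, \<dots>\<close>.
  The value of \<open>feller n \<xi>\<close> depends only on \<open>\<xi> 1, \<dots>, \<xi> n\<close>, and it is a partition of \<open>n\<close>
  whenever \<open>n \<ge> 1\<close> and \<open>\<xi> 1\<close> holds.
\<close>

definition feller :: "nat \<Rightarrow> (nat \<Rightarrow> bool) \<Rightarrow> nat \<Rightarrow> nat" where
  "feller n \<xi> i =
     (if i \<in> {1..n} then
        (\<Sum>j=1..n-i. of_bool (\<xi> j) * (\<Prod>k=j+1..j+i-1. 1 - of_bool (\<xi> k)) * of_bool (\<xi> (i + j)))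
        + of_bool (\<xi> (n - i + 1)) * (\<Prod>k=n-i+2..n. 1 - of_bool (\<xi> k))
      else 0)"

definition feller_measure :: "real \<Rightarrow> (nat \<Rightarrow> bool) measure" where
  "feller_measure \<theta> = (\<Pi>\<^sub>M i\<in>{1..}. measure_pmf (bernoulli_pmf (\<theta> / (\<theta> + real i - 1))))"

definition binary_strings :: "nat \<Rightarrow> (nat \<Rightarrow> bool) set" where
  "binary_strings n = {\<xi> \<in> {1..n} \<rightarrow>\<^sub>E UNIV. \<xi> 1}"

definition truncate :: "nat \<Rightarrow> (nat \<Rightarrow> nat) \<Rightarrow> nat \<Rightarrow> nat" where
  "truncate m \<alpha> i = (if i \<le> m then \<alpha> i else 0)"

definition L1_limit :: "'a measure \<Rightarrow> (nat \<Rightarrow> 'a \<Rightarrow> real) \<Rightarrow> ('a \<Rightarrow> real) \<Rightarrow> bool" where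
  "L1_limit M f g \<longleftrightarrow> (\<forall>n. integrable M (f n)) \<and> integrable M g \<and>
     (\<lambda>n. \<integral>\<omega>. \<bar>f n \<omega> - g \<omega>\<bar> \<partial>M) \<longlonglongrightarrow> 0"

text \<open>
  Below, \<open>h m\<close> is the limit of \<open>\<eta>\<^bsub>n,m\<^esub>\<close> as \<open>n\<close> tends to infinity. The case \<open>m = 0\<close> imposes nothing, since
  \<open>\<eta>\<^bsub>n,0\<^esub>\<close> is the constant value of \<open>\<eta>\<close> at the empty partition.
  Finiteness of the expectation of \<open>\<eta>_inf\<close> is the integrability contained in \<open>L1_limit\<close>.
\<close>

definition asymptotically_ewens :: "real \<Rightarrow> (nat \<Rightarrow> (nat \<Rightarrow> nat) measure) \<Rightarrow> bool" where
  "asymptotically_ewens \<theta> P \<longleftrightarrow>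
     (\<exists>\<eta>. (\<forall>k. \<forall>\<alpha>\<in>partitions k. 0 \<le> \<eta> \<alpha>) \<and>
          (\<forall>n\<ge>1. 0 < ewens_norm \<theta> \<eta> n) \<and>
          (\<forall>n\<ge>1. P n = perturbed_ewens \<theta> \<eta> n) \<and>
          (\<exists>h \<eta>_inf.
             L1_limit (feller_measure \<theta>) (\<lambda>n \<xi>. \<eta> (truncate n (feller n \<xi>))) \<eta>_inf \<and>
             (\<forall>m. L1_limit (feller_measure \<theta>) (\<lambda>n \<xi>. \<eta> (truncate m (feller n \<xi>))) (h m)) \<and>
             L1_limit (feller_measure \<theta>) h \<eta>_inf \<and>
             0 < (\<integral>\<xi>. \<eta>_inf \<xi> \<partial>feller_measure \<theta>)))"

text \<open>
  Convergence in distribution of \<open>X n\<close>, defined on the probability space \<open>M n\<close>, to \<open>Y\<close>, defined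
  on \<open>N\<close>. The library's \<open>weak_conv_m\<close> covers only real-valued random variables.
\<close>

definition converges_in_distribution ::
  "(nat \<Rightarrow> 'a measure) \<Rightarrow> (nat \<Rightarrow> 'a \<Rightarrow> 'x::topological_space) \<Rightarrow> 'b measure \<Rightarrow> ('b \<Rightarrow> 'x) \<Rightarrow> bool"
where
  "converges_in_distribution M X N Y \<longleftrightarrow>
     (\<forall>f :: 'x \<Rightarrow> real. continuous_on UNIV f \<longrightarrow> bounded (range f) \<longrightarrow>
        (\<lambda>n. \<integral>\<omega>. f (X n \<omega>) \<partial>M n) \<longlonglongrightarrow> (\<integral>\<omega>. f (Y \<omega>) \<partial>N))"

end

theory Submission
  imports Defs
begin

text \<open>
  Under \<open>feller_measure\<close> the partition \<open>feller n\<close> has the Ewens law, so expectations under the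
  perturbed measure are ratios \<open>E[\<eta>\<^sub>n f(X\<^sub>n)] / E[\<eta>\<^sub>n]\<close> with \<open>\<eta>\<^sub>n = \<eta> (feller n \<xi>)\<close>. As \<open>\<eta>\<^sub>n\<close> converges
  in \<open>L\<^sup>1\<close>, it may be replaced by \<open>\<eta>\<^sub>d\<close> for a large fixed \<open>d\<close>, which depends only on
  \<open>\<xi> 1, \<dots>, \<xi> d\<close>. The hypothesis on \<open>X\<^sub>n\<close> says that these coordinates are asymptotically irrelevant
  for \<open>X\<^sub>n\<close>, so for Lipschitz \<open>f\<close> the expectation factorises in the limit. Bounded Lipschitz test
  functions suffice, because a bounded continuous function is the increasing limit of its
  inf-convolutions \<open>x \<mapsto> INF y. f y + k * dist x y\<close>; no separability is needed.
\<close>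

subsection \<open>Independent coordinates\<close>

text \<open>Dependence means agreement on \<open>J\<close> over all sequences, with no sigma-algebra
  involved. For finite \<open>J\<close> it yields measurability, boundedness and integrability, and
  for disjoint finite sets independence.\<close>

definition depends_on :: "nat set \<Rightarrow> ((nat \<Rightarrow> bool) \<Rightarrow> 'a) \<Rightarrow> bool" where
  "depends_on J F \<longleftrightarrow> (\<forall>\<xi> \<xi>'. (\<forall>i\<in>J. \<xi> i = \<xi>' i) \<longrightarrow> F \<xi> = F \<xi>')"

lemma depends_onD: "depends_on J F \<Longrightarrow> (\<And>i. i \<in> J \<Longrightarrow> \<xi> i = \<xi>' i) \<Longrightarrow> F \<xi> = F \<xi>'"
  unfolding depends_on_def by blast

lemma depends_on_restrict:
  assumes "depends_on J F"
  shows "F (restrict \<xi> J) = F \<xi>"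
  by (rule depends_onD[OF assms]) simp

lemma depends_on_compose: "depends_on J F \<Longrightarrow> depends_on J (\<lambda>\<xi>. g (F \<xi>))"
  unfolding depends_on_def by metis

lemma prob_space_feller_measure: "prob_space (feller_measure \<theta>)"
  unfolding feller_measure_def by (intro prob_space_PiM measure_pmf.prob_space_axioms)

text \<open>Finite products of finite discrete spaces are discrete, so any function of finitely many
  bits is measurable.\<close>

lemma sets_PiM_measure_pmf:
  fixes p :: "'i \<Rightarrow> bool pmf"
  assumes "finite J"
  shows "sets (\<Pi>\<^sub>M i\<in>J. measure_pmf (p i)) = sets (count_space (J \<rightarrow>\<^sub>E UNIV))"
proof -
  have "sets (\<Pi>\<^sub>M i\<in>J. measure_pmf (p i)) = sets (\<Pi>\<^sub>M i\<in>J. count_space UNIV)"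
    by (rule sets_PiM_cong) auto
  then show ?thesis
    using assms by (simp add: count_space_PiM_finite)
qed

lemma borel_measurable_PiM_measure_pmf:
  fixes F :: "(nat \<Rightarrow> bool) \<Rightarrow> real"
  assumes "finite J"
  shows "F \<in> borel_measurable (\<Pi>\<^sub>M i\<in>J. measure_pmf (p i :: bool pmf))"
  unfolding measurable_cong_sets[OF sets_PiM_measure_pmf[OF assms] refl] by simp

lemma depends_on_borel_measurable:
  fixes F :: "(nat \<Rightarrow> bool) \<Rightarrow> real"
  assumes F: "depends_on J F" and J: "finite J" "J \<subseteq> {1..}"
  shows "F \<in> borel_measurable (feller_measure \<theta>)"
proof -
  have "(\<lambda>\<xi>. F (restrict \<xi> J)) \<in> borel_measurable (feller_measure \<theta>)"
    unfolding feller_measure_def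
    by (rule measurable_compose[OF measurable_restrict_subset[OF J(2)]
          borel_measurable_PiM_measure_pmf[OF J(1)]])
  then show ?thesis
    by (simp add: depends_on_restrict[OF F])
qed

lemma depends_on_bounded:
  fixes F :: "(nat \<Rightarrow> bool) \<Rightarrow> real"
  assumes F: "depends_on J F" and J: "finite J"
  obtains B where "\<And>\<xi>. \<bar>F \<xi>\<bar> \<le> B"
proof -
  have "finite ((\<lambda>\<xi>. \<bar>F \<xi>\<bar>) ` (J \<rightarrow>\<^sub>E UNIV))"
    using J by (intro finite_imageI finite_PiE) auto
  then obtain B where B: "\<And>\<xi>. \<xi> \<in> J \<rightarrow>\<^sub>E UNIV \<Longrightarrow> \<bar>F \<xi>\<bar> \<le> B"
    using bdd_above_finite unfolding bdd_above_def by (metis imageI)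
  have "\<bar>F \<xi>\<bar> \<le> B" for \<xi>
    using B[of "restrict \<xi> J"] depends_on_restrict[OF F, of \<xi>] by simp
  then show ?thesis
    by (rule that)
qed

lemma depends_on_integrable:
  fixes F :: "(nat \<Rightarrow> bool) \<Rightarrow> real"
  assumes F: "depends_on J F" and J: "finite J" "J \<subseteq> {1..}"
  shows "integrable (feller_measure \<theta>) F"
proof -
  interpret prob_space "feller_measure \<theta>" by (rule prob_space_feller_measure)
  obtain B where "\<And>\<xi>. \<bar>F \<xi>\<bar> \<le> B"
    using depends_on_bounded[OF F J(1)] by blast
  then show ?thesis
    by (intro integrable_const_bound[where B = B] depends_on_borel_measurable[OF F J]) auto
qed

text \<open>The joint law of the coordinates is the product of their marginals, so they are
  independent; grouping them into the disjoint blocks \<open>A\<close> and \<open>B\<close> keeps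
  independence.\<close>

lemma depends_on_integral_mult:
  fixes F G :: "(nat \<Rightarrow> bool) \<Rightarrow> real"
  assumes F: "depends_on A F" and G: "depends_on B G"
    and AB: "finite A" "finite B" "A \<subseteq> {1..}" "B \<subseteq> {1..}" "A \<inter> B = {}"
  shows "(\<integral>\<xi>. F \<xi> * G \<xi> \<partial>feller_measure \<theta>) =
    (\<integral>\<xi>. F \<xi> \<partial>feller_measure \<theta>) * (\<integral>\<xi>. G \<xi> \<partial>feller_measure \<theta>)"
proof -
  interpret prob_space "feller_measure \<theta>" by (rule prob_space_feller_measure)
  define p where "p i = bernoulli_pmf (\<theta> / (\<theta> + real i - 1))" for i :: nat
  have M: "feller_measure \<theta> = (\<Pi>\<^sub>M i\<in>{1..}. measure_pmf (p i))"
    by (simp add: feller_measure_def p_def)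
  have comp: "distr (feller_measure \<theta>) (measure_pmf (p i)) (\<lambda>\<xi>. \<xi> i) = measure_pmf (p i)"
    if "i \<in> {1..}" for i
    using that distr_PiM_component[of "{1..}" "\<lambda>i. measure_pmf (p i)" i]
    unfolding M by (simp add: measure_pmf.prob_space_axioms)
  then have PiM_comp: "(\<Pi>\<^sub>M i\<in>{1..}. distr (feller_measure \<theta>) (measure_pmf (p i)) (\<lambda>\<xi>. \<xi> i))
      = (\<Pi>\<^sub>M i\<in>{1..}. measure_pmf (p i))"
    by (intro PiM_cong refl)
  have "indep_vars (\<lambda>i. measure_pmf (p i)) (\<lambda>i \<xi>. \<xi> i) {1..}"
  proof (subst indep_vars_iff_distr_eq_PiM')
    \<comment> \<open>Sequences in the product space are extensional on \<open>{1..}\<close>, so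
      this restriction is the identity there.\<close>
    have "distr (feller_measure \<theta>) (\<Pi>\<^sub>M i\<in>{1..}. measure_pmf (p i)) (\<lambda>x. \<lambda>i\<in>{1..}. x i)
      = distr (feller_measure \<theta>) (feller_measure \<theta>) (\<lambda>x. x)"
      unfolding M by (intro distr_cong) (auto simp: space_PiM)
    also have "\<dots> = (\<Pi>\<^sub>M i\<in>{1..}. distr (feller_measure \<theta>) (measure_pmf (p i)) (\<lambda>\<xi>. \<xi> i))"
      unfolding PiM_comp distr_id by (rule M)
    finally show "distr (feller_measure \<theta>) (\<Pi>\<^sub>M i\<in>{1..}. measure_pmf (p i)) (\<lambda>x. \<lambda>i\<in>{1..}. x i)
      = (\<Pi>\<^sub>M i\<in>{1..}. distr (feller_measure \<theta>) (measure_pmf (p i)) (\<lambda>\<xi>. \<xi> i))" .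
  qed (auto simp: M)
  then have "indep_var (\<Pi>\<^sub>M i\<in>A. measure_pmf (p i)) (\<lambda>\<xi>. restrict \<xi> A)
      (\<Pi>\<^sub>M i\<in>B. measure_pmf (p i)) (\<lambda>\<xi>. restrict \<xi> B)"
    by (rule indep_var_restrict) (use AB in auto)
  then have "indep_var borel (F \<circ> (\<lambda>\<xi>. restrict \<xi> A)) borel (G \<circ> (\<lambda>\<xi>. restrict \<xi> B))"
    by (rule indep_var_compose) (simp_all add: borel_measurable_PiM_measure_pmf AB)
  then have "indep_var borel F borel G"
    by (simp add: comp_def depends_on_restrict[OF F] depends_on_restrict[OF G])
  then show ?thesis
    by (rule indep_var_lebesgue_integral) (use F G AB depends_on_integrable in blast)+
qed

lemma prob_feller_measure_Collect:
  assumes \<theta>: "\<theta> > 0" and J: "finite J" "J \<subseteq> {1..}"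
  shows "measure (feller_measure \<theta>) {\<xi> \<in> space (feller_measure \<theta>). \<forall>i\<in>J. \<xi> i = s i} =
    (\<Prod>i\<in>J. if s i then \<theta> / (\<theta> + real i - 1) else (real i - 1) / (\<theta> + real i - 1))"
proof -
  define p where "p i = bernoulli_pmf (\<theta> / (\<theta> + real i - 1))" for i :: nat
  interpret product_prob_space "\<lambda>i. measure_pmf (p i)" "{1..}" by standard
  have M: "feller_measure \<theta> = (\<Pi>\<^sub>M i\<in>{1..}. measure_pmf (p i))"
    by (simp add: feller_measure_def p_def)
  have "emeasure (feller_measure \<theta>) {\<xi> \<in> space (feller_measure \<theta>). \<forall>i\<in>J. \<xi> i \<in> {s i}} =
      (\<Prod>i\<in>J. emeasure (measure_pmf (p i)) {s i})"
    unfolding M using J by (intro emeasure_PiM_Collect) auto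
  also have "\<dots> = (\<Prod>i\<in>J. ennreal (pmf (p i) (s i)))"
    by (simp add: emeasure_pmf_single)
  also have "\<dots> = ennreal (\<Prod>i\<in>J. pmf (p i) (s i))"
    by (simp add: prod_ennreal)
  finally have "measure (feller_measure \<theta>) {\<xi> \<in> space (feller_measure \<theta>). \<forall>i\<in>J. \<xi> i = s i} =
      (\<Prod>i\<in>J. pmf (p i) (s i))"
    by (simp add: measure_def prod_nonneg)
  also have "\<dots> = (\<Prod>i\<in>J. if s i then \<theta> / (\<theta> + real i - 1) else (real i - 1) / (\<theta> + real i - 1))"
  proof (rule prod.cong)
    fix i assume "i \<in> J"
    \<comment> \<open>For i \<ge> 1 the parameter lies in [0, 1], so \<open>bernoulli_pmf\<close>
      does not clamp it.\<close>
    then have "real i \<ge> 1" using J by auto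
    then show "pmf (p i) (s i) =
        (if s i then \<theta> / (\<theta> + real i - 1) else (real i - 1) / (\<theta> + real i - 1))"
      using \<theta> unfolding p_def by (cases "s i") (auto simp: field_simps)
  qed simp
  finally show ?thesis .
qed

lemma AE_feller_measure_first:
  assumes "\<theta> > 0"
  shows "AE \<xi> in feller_measure \<theta>. \<xi> 1"
proof -
  \<comment> \<open>At index 1 the success probability is \<theta> / \<theta> = 1.\<close>
  have "AE x in measure_pmf (bernoulli_pmf (\<theta> / (\<theta> + real 1 - 1))). x"
    using assms by (simp add: AE_measure_pmf_iff set_pmf_iff all_bool_eq Ball_def)
  then show ?thesis
    unfolding feller_measure_def
    by (intro AE_PiM_component[where i = 1 and P = "\<lambda>b. b"])
      (auto simp: measure_pmf.prob_space_axioms)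
qed

subsection \<open>The Feller coupling\<close>

lemma prod_one_minus_of_bool:
  "finite A \<Longrightarrow> (\<Prod>k\<in>A. 1 - of_bool (P k)) = (of_bool (\<forall>k\<in>A. \<not> P k) :: nat)"
  by (induction A rule: finite_induct) auto

text \<open>A virtual 1 at position n + 1 merges both summands of \<open>feller\<close>: j is the
  left end of a spacing of length i, and j + i its right end. For i > n the set is empty, whereas i
  = 0 is excluded separately because both ends would coincide.\<close>

lemma feller_eq_card:
  "feller n \<xi> i = (if i = 0 then 0 else
     card {j. 1 \<le> j \<and> j + i \<le> n + 1 \<and> \<xi> j \<and> (j + i = n + 1 \<or> \<xi> (j + i)) \<and> (\<forall>k. j < k \<and> k < j + i \<longrightarrow> \<not> \<xi> k)})"
proof (cases "i \<in> {1..n}")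
  case True
  let ?B = "\<lambda>j. \<forall>k. j < k \<and> k < j + i \<longrightarrow> \<not> \<xi> k"
  \<comment> \<open>\<open>?S\<close> holds the spacings closed by a real 1, \<open>?T\<close> the
    one closed by the virtual 1 at n + 1.\<close>
  let ?S = "{j \<in> {1..n-i}. \<xi> j \<and> \<xi> (j + i) \<and> ?B j}"
  let ?T = "{j. j = n - i + 1 \<and> \<xi> j \<and> ?B j}"
  have "{j. 1 \<le> j \<and> j + i \<le> n + 1 \<and> \<xi> j \<and> (j + i = n + 1 \<or> \<xi> (j + i)) \<and> ?B j} = ?S \<union> ?T"
    using True by (auto simp: le_diff_conv2)
  moreover have "card (?S \<union> ?T) = card ?S + card ?T"
    by (intro card_Un_disjoint) (auto intro: finite_subset[of _ "{n - i + 1}"])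
  moreover have "(\<Sum>j=1..n-i. of_bool (\<xi> j) * (\<Prod>k=j+1..j+i-1. 1 - of_bool (\<xi> k)) * of_bool (\<xi> (i + j)))
      = card ?S"
  proof -
    have "of_bool (\<xi> j) * (\<Prod>k=j+1..j+i-1. 1 - of_bool (\<xi> k)) * of_bool (\<xi> (i + j))
      = (of_bool (\<xi> j \<and> \<xi> (j + i) \<and> ?B j) :: nat)" for j
    proof -
      have "(\<forall>k\<in>{j+1..j+i-1}. \<not> \<xi> k) \<longleftrightarrow> ?B j"
        using True by auto
      then show ?thesis
        by (subst prod_one_minus_of_bool) (auto simp: add.commute)
    qed
    then show ?thesis
      by (simp add: Int_def of_bool_def sum.If_cases)
  qed
  moreover have "of_bool (\<xi> (n - i + 1)) * (\<Prod>k=n-i+2..n. 1 - of_bool (\<xi> k)) = card ?T"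
  proof -
    have "(\<forall>k\<in>{n-i+2..n}. \<not> \<xi> k) \<longleftrightarrow> ?B (n - i + 1)"
      using True by auto
    moreover have "card ?T = of_bool (\<xi> (n - i + 1) \<and> ?B (n - i + 1))"
      by (cases "\<xi> (n - i + 1) \<and> ?B (n - i + 1)") (auto simp: card_eq_0_iff cong: conj_cong)
    ultimately show ?thesis
      by (subst prod_one_minus_of_bool) (auto simp del: of_bool_conj)
  qed
  ultimately show ?thesis
    using True unfolding feller_def by simp
next
  case False
  then show ?thesis
    by (auto simp: feller_def card_eq_0_iff)
qed

lemma depends_on_feller: "depends_on {1..n} (feller n)"
  unfolding depends_on_def
proof (intro allI impI ext)
  fix \<xi> \<xi>' :: "nat \<Rightarrow> bool" and i
  assume eq: "\<forall>i\<in>{1..n}. \<xi> i = \<xi>' i"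
  then have eq: "\<xi> k = \<xi>' k" if "1 \<le> k" "k \<le> n" for k
    using that by auto
  \<comment> \<open>The bit at n + 1 is never read: there the left disjunct already decides.\<close>
  then have eq': "(j + i = n + 1 \<or> \<xi> (j + i)) \<longleftrightarrow> (j + i = n + 1 \<or> \<xi>' (j + i))"
    if "1 \<le> j" "j + i \<le> n + 1" for j
    using that by (cases "j + i = n + 1") auto
  have "{j. 1 \<le> j \<and> j + i \<le> n + 1 \<and> \<xi> j \<and> (j + i = n + 1 \<or> \<xi> (j + i)) \<and>
      (\<forall>k. j < k \<and> k < j + i \<longrightarrow> \<not> \<xi> k)} =
    {j. 1 \<le> j \<and> j + i \<le> n + 1 \<and> \<xi>' j \<and> (j + i = n + 1 \<or> \<xi>' (j + i)) \<and>
      (\<forall>k. j < k \<and> k < j + i \<longrightarrow> \<not> \<xi>' k)}" if "i \<noteq> 0"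
    using that eq' by (intro Collect_cong conj_cong refl) (auto simp: eq)
  then show "feller n \<xi> i = feller n \<xi>' i"
    unfolding feller_eq_card by (cases "i = 0") simp_all
qed

text \<open>If p is the last 1 among 1..n, the final spacing has length n + 1 - p, and p acts as the
  virtual 1 for the shorter string ending at p - 1. All other spacings are therefore those of
  \<open>feller (p - 1)\<close>.\<close>

lemma feller_remove_last_block:
  assumes p: "1 \<le> p" "p \<le> n" "\<xi> p" and zero: "\<And>k. p < k \<Longrightarrow> k \<le> n \<Longrightarrow> \<not> \<xi> k"
  shows "feller n \<xi> = (feller (p - 1) \<xi>)(n - p + 1 := feller (p - 1) \<xi> (n - p + 1) + 1)"
proof
  fix i
  define S where "S m = {j. 1 \<le> j \<and> j + i \<le> m + 1 \<and> \<xi> j \<and> (j + i = m + 1 \<or> \<xi> (j + i)) \<and>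
      (\<forall>k. j < k \<and> k < j + i \<longrightarrow> \<not> \<xi> k)}" for m
  show "feller n \<xi> i = ((feller (p - 1) \<xi>)(n - p + 1 := feller (p - 1) \<xi> (n - p + 1) + 1)) i"
  proof (cases "i = 0")
    case True
    then show ?thesis by (simp add: feller_eq_card)
  next
    case False
    have "S n = S (p - 1) \<union> (if i = n - p + 1 then {p} else {})"
    proof (intro equalityI subsetI)
      fix j assume j: "j \<in> S n"
      show "j \<in> S (p - 1) \<union> (if i = n - p + 1 then {p} else {})"
      proof (cases "j + i = n + 1")
        case True
        \<comment> \<open>The bit at j is a 1, so j cannot exceed p, and j < p would put the 1 at p
          strictly inside the spacing.\<close>
        then have "\<not> p < j" "\<not> j < p"
          using j p zero[of j] False by (auto simp: S_def)
        then show ?thesis using True p by auto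
      next
        case ne: False
        \<comment> \<open>The right end is a real 1, hence at most p; if it equals p, it is the
          virtual end of the shorter string.\<close>
        then have "j + i \<le> p"
          using j zero[of "j + i"] by (force simp: S_def)
        then show ?thesis using j p ne by (auto simp: S_def)
      qed
    next
      fix j assume j: "j \<in> S (p - 1) \<union> (if i = n - p + 1 then {p} else {})"
      show "j \<in> S n"
      proof (cases "j \<in> S (p - 1)")
        case True
        then show ?thesis using p by (auto simp: S_def)
      next
        case False
        then have "j = p" "i = n - p + 1" using j by (auto split: if_splits)
        then show ?thesis using p zero by (auto simp: S_def)
      qed
    qed
    moreover have "p \<notin> S (p - 1)" "finite (S (p - 1))"
      using False p by (auto simp: S_def intro: finite_subset[of _ "{..p}"])
    ultimately have "card (S n) = card (S (p - 1)) + (if i = n - p + 1 then 1 else 0)"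
      by auto
    moreover have "feller m \<xi> i = card (S m)" for m
      using False by (simp add: feller_eq_card S_def)
    ultimately show ?thesis by auto
  qed
qed

text \<open>Exactly one indicator is nonzero, that of the last 1, which exists because of \<xi> 1.
  In each summand the indicator reads the positions p..n and the other factor the positions 1..p -
  1, which prepares the use of independence.\<close>

lemma feller_last_block_sum:
  fixes \<phi> :: "(nat \<Rightarrow> nat) \<Rightarrow> real"
  assumes "\<xi> 1" "n \<ge> 1"
  shows "\<phi> (feller n \<xi>) = (\<Sum>p=1..n. of_bool (\<forall>k\<in>{p..n}. \<xi> k = (k = p)) *
    \<phi> ((feller (p - 1) \<xi>)(n - p + 1 := feller (p - 1) \<xi> (n - p + 1) + 1)))"
proof -
  define q where "q = Max {p \<in> {1..n}. \<xi> p}"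
  have "q \<in> {p \<in> {1..n}. \<xi> p}"
    unfolding q_def using assms by (intro Max_in) auto
  then have q: "1 \<le> q" "q \<le> n" "\<xi> q" by auto
  have zero: "\<not> \<xi> k" if "q < k" "k \<le> n" for k
  proof
    assume "\<xi> k"
    then have "k \<le> q"
      unfolding q_def using that q by (intro Max_ge) auto
    with that show False by simp
  qed
  have "(\<forall>k\<in>{p..n}. \<xi> k = (k = p)) \<longleftrightarrow> p = q" if "p \<in> {1..n}" for p
  proof
    assume *: "\<forall>k\<in>{p..n}. \<xi> k = (k = p)"
    then have "\<xi> p" using that by simp
    then have "\<not> q < p" using zero[of p] that by auto
    with * q show "p = q" by auto
  next
    assume "p = q"
    then show "\<forall>k\<in>{p..n}. \<xi> k = (k = p)"
      using q zero by (metis atLeastAtMost_iff le_neq_implies_less)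
  qed
  then have "(\<Sum>p=1..n. of_bool (\<forall>k\<in>{p..n}. \<xi> k = (k = p)) *
      \<phi> ((feller (p - 1) \<xi>)(n - p + 1 := feller (p - 1) \<xi> (n - p + 1) + 1)))
    = (\<Sum>p=1..n. if p = q then
      \<phi> ((feller (p - 1) \<xi>)(n - p + 1 := feller (p - 1) \<xi> (n - p + 1) + 1)) else 0)"
    by (intro sum.cong refl) (auto simp: of_bool_def)
  also have "\<dots> = \<phi> (feller n \<xi>)"
    using q feller_remove_last_block[of q n \<xi>, OF q zero] by (simp add: sum.delta)
  finally show ?thesis ..
qed

text \<open>The left side is the probability that p is the last 1 among 1..n. The numerators
  multiply to \<theta> p (p + 1) ... (n - 1), the denominators to the product from \<theta> + p - 1
  up to \<theta> + n - 1.\<close>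

lemma last_block_prob:
  assumes "\<theta> > 0" "1 \<le> p" "p \<le> n"
  shows "(\<Prod>k=p..n. if k = p then \<theta> / (\<theta> + real k - 1) else (real k - 1) / (\<theta> + real k - 1)) =
    \<theta> * (fact (n - 1) / fact (p - 1)) * (pochhammer \<theta> (p - 1) / pochhammer \<theta> n)"
  using assms(3)
proof (induction n rule: nat_induct_at_least)
  case base
  obtain m where m: "p = Suc m" using assms(2) by (cases p) auto
  have "pochhammer \<theta> m \<noteq> 0"
    using pochhammer_pos[OF assms(1), of m] by simp
  then show ?case
    by (simp add: m pochhammer_Suc)
next
  case (Suc n)
  obtain m where m: "n = Suc m" using Suc.hyps assms(2) by (cases n) auto
  have "\<theta> + real n \<noteq> 0" using assms(1) by linarith
  then show ?case
    using Suc.hyps assms(2) unfolding prod.nat_ivl_Suc'[OF le_SucI[OF Suc.hyps]] Suc.IH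
    by (simp add: m pochhammer_Suc field_simps)
qed

section \<open>Adding a part to a partition and its effect on the Ewens weight\<close>

lemma sum_weighted_extend:
  fixes \<alpha> :: "nat \<Rightarrow> nat"
  assumes "n \<le> N" "\<And>i. i \<notin> {1..n} \<Longrightarrow> \<alpha> i = 0"
  shows "(\<Sum>i=1..n. i * \<alpha> i) = (\<Sum>i=1..N. i * \<alpha> i)"
  using assms by (intro sum.mono_neutral_left) auto

text \<open>With a longer range of summation, partitions of n - j and of n can be compared through
  one common sum. A size i with \<alpha> i > 0 contributes at least i to a sum equal to n, which
  forces i \<le> n.\<close>

lemma partitions_iff:
  assumes "n \<le> N"
  shows "\<alpha> \<in> partitions n \<longleftrightarrow> (\<forall>i. i \<notin> {1..N} \<longrightarrow> \<alpha> i = 0) \<and> (\<Sum>i=1..N. i * \<alpha> i) = n"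
proof
  assume "\<alpha> \<in> partitions n"
  then show "(\<forall>i. i \<notin> {1..N} \<longrightarrow> \<alpha> i = 0) \<and> (\<Sum>i=1..N. i * \<alpha> i) = n"
    using assms sum_weighted_extend[OF assms, of \<alpha>] by (auto simp: partitions_def)
next
  assume *: "(\<forall>i. i \<notin> {1..N} \<longrightarrow> \<alpha> i = 0) \<and> (\<Sum>i=1..N. i * \<alpha> i) = n"
  have "\<alpha> i = 0" if "i \<notin> {1..n}" for i
  proof (rule ccontr)
    assume "\<alpha> i \<noteq> 0"
    then have i: "i \<in> {1..N}" using * by auto
    then have "i * \<alpha> i \<le> (\<Sum>i=1..N. i * \<alpha> i)"
      by (intro member_le_sum) auto
    moreover have "i * 1 \<le> i * \<alpha> i" using \<open>\<alpha> i \<noteq> 0\<close> by (intro mult_le_mono2) simp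
    ultimately have "i \<le> n" using conjunct2[OF *] by linarith
    then show False using i that by auto
  qed
  then show "\<alpha> \<in> partitions n"
    using * sum_weighted_extend[OF assms, of \<alpha>] by (auto simp: partitions_def)
qed

lemma finite_partitions: "finite (partitions n)"
proof (rule finite_subset)
  show "partitions n \<subseteq> {\<alpha>. \<forall>i. (i \<in> {1..n} \<longrightarrow> \<alpha> i \<in> {..n}) \<and> (i \<notin> {1..n} \<longrightarrow> \<alpha> i = 0)}"
  proof safe
    fix \<alpha> i assume \<alpha>: "\<alpha> \<in> partitions n" and i: "i \<in> {1..n}"
    have "1 * \<alpha> i \<le> i * \<alpha> i" using i by (intro mult_le_mono1) simp
    also have "\<dots> \<le> (\<Sum>i=1..n. i * \<alpha> i)" using i by (intro member_le_sum) auto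
    finally show "\<alpha> i \<le> n" using \<alpha> by (simp add: partitions_def)
  qed (auto simp: partitions_def)
qed (intro finite_set_of_finite_funs; simp)

lemma ewens_weight_extend:
  assumes "\<alpha> \<in> partitions n" "n \<le> N"
  shows "ewens_weight \<theta> N \<alpha> = ewens_weight \<theta> n \<alpha>"
  unfolding ewens_weight_def using assms
  by (intro prod.mono_neutral_right) (auto simp: partitions_def)

text \<open>Only the factor at j changes, by the ratio \<theta> / (j (\<beta> j + 1)).\<close>

lemma ewens_weight_add_part:
  assumes "1 \<le> j" "j \<le> n"
  shows "real j * real (\<beta> j + 1) * ewens_weight \<theta> n (\<beta>(j := \<beta> j + 1)) = \<theta> * ewens_weight \<theta> n \<beta>"
proof -
  have j: "j \<in> {1..n}" using assms by simp
  have 1: "ewens_weight \<theta> n (\<beta>(j := \<beta> j + 1)) =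
      \<theta> ^ (\<beta> j + 1) / (real j ^ (\<beta> j + 1) * fact (\<beta> j + 1)) *
      (\<Prod>i\<in>{1..n} - {j}. \<theta> ^ \<beta> i / (real i ^ \<beta> i * fact (\<beta> i)))"
    unfolding ewens_weight_def by (subst prod.remove[OF _ j]) auto
  have 2: "ewens_weight \<theta> n \<beta> = \<theta> ^ \<beta> j / (real j ^ \<beta> j * fact (\<beta> j)) *
      (\<Prod>i\<in>{1..n} - {j}. \<theta> ^ \<beta> i / (real i ^ \<beta> i * fact (\<beta> i)))"
    unfolding ewens_weight_def by (subst prod.remove[OF _ j]) auto
  have "real j * real (\<beta> j + 1) * (\<theta> ^ (\<beta> j + 1) / (real j ^ (\<beta> j + 1) * fact (\<beta> j + 1)))
      = \<theta> * (\<theta> ^ \<beta> j / (real j ^ \<beta> j * fact (\<beta> j)))"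
    using assms by (simp add: divide_simps)
  then show ?thesis
    unfolding 1 2 mult.assoc[symmetric] by simp
qed

text \<open>Adding one part of size j is a bijection from the partitions of n - j onto the
  partitions of n with \<alpha> j > 0. The factor j * \<alpha> j kills the remaining partitions of n
  and absorbs the change of weight.\<close>

lemma sum_partitions_add_part:
  fixes \<phi> :: "(nat \<Rightarrow> nat) \<Rightarrow> real"
  assumes j: "1 \<le> j" "j \<le> n"
  shows "(\<Sum>\<beta>\<in>partitions (n - j). \<phi> (\<beta>(j := \<beta> j + 1)) * (\<theta> * ewens_weight \<theta> (n - j) \<beta>)) =
    (\<Sum>\<alpha>\<in>partitions n. \<phi> \<alpha> * (real (j * \<alpha> j) * ewens_weight \<theta> n \<alpha>))"
proof -
  \<comment> \<open>The additive form avoids truncated subtraction and serves both for adding a part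
    (m = \<alpha> j + 1) and for removing one (m = \<alpha> j - 1).\<close>
  have split: "(\<Sum>i=1..n. i * (\<alpha>(j := m)) i) + j * \<alpha> j = (\<Sum>i=1..n. i * \<alpha> i) + j * m"
    for \<alpha> :: "nat \<Rightarrow> nat" and m
  proof -
    have "(\<Sum>i\<in>{1..n} - {j}. i * (\<alpha>(j := m)) i) = (\<Sum>i\<in>{1..n} - {j}. i * \<alpha> i)"
      by (intro sum.cong) auto
    then show ?thesis
      using j by (simp only: sum.remove[of "{1..n}" j] finite_atLeastAtMost atLeastAtMost_iff) simp
  qed
  have "(\<Sum>\<beta>\<in>partitions (n - j). \<phi> (\<beta>(j := \<beta> j + 1)) * (\<theta> * ewens_weight \<theta> (n - j) \<beta>)) =
      (\<Sum>\<alpha>\<in>{\<alpha> \<in> partitions n. \<alpha> j > 0}. \<phi> \<alpha> * (real (j * \<alpha> j) * ewens_weight \<theta> n \<alpha>))"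
  proof (rule sum.reindex_bij_witness[where i = "\<lambda>\<alpha>. \<alpha>(j := \<alpha> j - 1)" and j = "\<lambda>\<beta>. \<beta>(j := \<beta> j + 1)"])
    fix \<beta> assume \<beta>: "\<beta> \<in> partitions (n - j)"
    show "\<beta>(j := \<beta> j + 1) \<in> {\<alpha> \<in> partitions n. \<alpha> j > 0}"
      using \<beta> j split[of \<beta> "\<beta> j + 1"]
      by (auto simp: partitions_iff[of "n - j" n] partitions_iff[of n n] algebra_simps)
    show "\<phi> (\<beta>(j := \<beta> j + 1)) *
        (real (j * (\<beta>(j := \<beta> j + 1)) j) * ewens_weight \<theta> n (\<beta>(j := \<beta> j + 1))) =
      \<phi> (\<beta>(j := \<beta> j + 1)) * (\<theta> * ewens_weight \<theta> (n - j) \<beta>)"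
      using ewens_weight_add_part[OF j, of \<beta> \<theta>] ewens_weight_extend[OF \<beta>, of n]
      by (simp add: algebra_simps)
  next
    fix \<alpha> assume \<alpha>: "\<alpha> \<in> {\<alpha> \<in> partitions n. \<alpha> j > 0}"
    then obtain m where "\<alpha> j = Suc m" by (auto simp: gr0_conv_Suc)
    then show "\<alpha>(j := \<alpha> j - 1) \<in> partitions (n - j)"
      using \<alpha> j split[of \<alpha> "\<alpha> j - 1"]
      by (auto simp: partitions_iff[of "n - j" n] partitions_iff[of n n])
  qed auto
  also have "\<dots> = (\<Sum>\<alpha>\<in>partitions n. \<phi> \<alpha> * (real (j * \<alpha> j) * ewens_weight \<theta> n \<alpha>))"
    by (intro sum.mono_neutral_left finite_partitions) auto
  finally show ?thesis .
qed

text \<open>Conditioning on the last index with \<open>\<xi> p = 1\<close> removes a part of size \<open>n - p + 1\<close>, and the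
  identity \<open>\<Sum>j. j * \<alpha> j = n\<close> closes the induction.\<close>

lemma integral_feller:
  fixes \<phi> :: "(nat \<Rightarrow> nat) \<Rightarrow> real"
  assumes \<theta>: "\<theta> > 0"
  shows "(\<integral>\<xi>. \<phi> (feller n \<xi>) \<partial>feller_measure \<theta>) =
    fact n / pochhammer \<theta> n * (\<Sum>\<alpha>\<in>partitions n. \<phi> \<alpha> * ewens_weight \<theta> n \<alpha>)"
\<comment> \<open>\<phi> is generalised because the hypothesis is applied to \<phi> composed with
  the addition of a part; the induction is strong because the last 1 may stand at any p.\<close>
proof (induction n arbitrary: \<phi> rule: less_induct)
  case (less n)
  interpret prob_space "feller_measure \<theta>" by (rule prob_space_feller_measure)
  show ?case
  proof (cases "n = 0")
    case True
    have "partitions 0 = {\<lambda>_. 0}" "feller 0 = (\<lambda>_ _. 0)"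
      by (auto simp: partitions_def feller_def fun_eq_iff)
    then show ?thesis
      using True by (simp add: ewens_weight_def prob_space)
  next
    case False
    then have n: "n \<ge> 1" by simp
    define add where "add j \<beta> = \<beta>(j := \<beta> j + 1)" for j and \<beta> :: "nat \<Rightarrow> nat"
    \<comment> \<open>This is the last-block probability times the factor (p - 1)! /
      \<open>pochhammer \<theta> (p - 1)\<close> from the induction hypothesis; p cancels.\<close>
    define C where "C = \<theta> * fact (n - 1) / pochhammer \<theta> n"
    let ?A = "\<lambda>p \<xi>. of_bool (\<forall>k\<in>{p..n}. \<xi> k = (k = p)) :: real"
    have depA: "depends_on {p..n} (?A p)" for p
      by (auto simp: depends_on_def of_bool_def)
    have depG: "depends_on {1..p-1} (\<lambda>\<xi>. \<phi> (add (n - p + 1) (feller (p - 1) \<xi>)))" for p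
      by (rule depends_on_compose[OF depends_on_feller])
    have depAG: "depends_on {1..n} (\<lambda>\<xi>. ?A p \<xi> * \<phi> (add (n - p + 1) (feller (p - 1) \<xi>)))"
      if "p \<in> {1..n}" for p
      unfolding depends_on_def
    proof (intro allI impI)
      fix \<xi> \<xi>' :: "nat \<Rightarrow> bool" assume "\<forall>i\<in>{1..n}. \<xi> i = \<xi>' i"
      then show "?A p \<xi> * \<phi> (add (n - p + 1) (feller (p - 1) \<xi>)) =
          ?A p \<xi>' * \<phi> (add (n - p + 1) (feller (p - 1) \<xi>'))"
        using that by (intro arg_cong2[of _ _ _ _ "(*)"] depends_onD[OF depA] depends_onD[OF depG]) auto
    qed
    have "(\<integral>\<xi>. \<phi> (feller n \<xi>) \<partial>feller_measure \<theta>) =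
        (\<integral>\<xi>. (\<Sum>p=1..n. ?A p \<xi> * \<phi> (add (n - p + 1) (feller (p - 1) \<xi>))) \<partial>feller_measure \<theta>)"
    proof (rule integral_cong_AE)
      show "(\<lambda>\<xi>. \<phi> (feller n \<xi>)) \<in> borel_measurable (feller_measure \<theta>)"
        by (rule depends_on_borel_measurable[OF depends_on_compose[OF depends_on_feller]]) auto
      show "(\<lambda>\<xi>. \<Sum>p=1..n. ?A p \<xi> * \<phi> (add (n - p + 1) (feller (p - 1) \<xi>)))
          \<in> borel_measurable (feller_measure \<theta>)"
        by (intro borel_measurable_sum depends_on_borel_measurable[OF depAG]) auto
      \<comment> \<open>The decomposition requires \<xi> 1, which holds almost surely.\<close>
      show "AE \<xi> in feller_measure \<theta>. \<phi> (feller n \<xi>) =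
          (\<Sum>p=1..n. ?A p \<xi> * \<phi> (add (n - p + 1) (feller (p - 1) \<xi>)))"
        using AE_feller_measure_first[OF \<theta>]
        by eventually_elim (unfold add_def, rule feller_last_block_sum[OF _ n])
    qed
    also have "\<dots> = (\<Sum>p=1..n.
        \<integral>\<xi>. ?A p \<xi> * \<phi> (add (n - p + 1) (feller (p - 1) \<xi>)) \<partial>feller_measure \<theta>)"
      by (intro Bochner_Integration.integral_sum depends_on_integrable[OF depAG]) auto
    also have "\<dots> = (\<Sum>p=1..n. C *
        (\<Sum>\<beta>\<in>partitions (p - 1). \<phi> (add (n - p + 1) \<beta>) * ewens_weight \<theta> (p - 1) \<beta>))"
    proof (rule sum.cong[OF refl])
      fix p assume p: "p \<in> {1..n}"
      have "(\<integral>\<xi>. ?A p \<xi> \<partial>feller_measure \<theta>) =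
          measure (feller_measure \<theta>) {\<xi> \<in> space (feller_measure \<theta>). \<forall>k\<in>{p..n}. \<xi> k = (k = p)}"
      proof -
        have "(\<integral>\<xi>. ?A p \<xi> \<partial>feller_measure \<theta>) =
            (\<integral>\<xi>. indicator {\<xi>. \<forall>k\<in>{p..n}. \<xi> k = (k = p)} \<xi> \<partial>feller_measure \<theta>)"
          by (intro Bochner_Integration.integral_cong) (auto simp: indicator_def)
        then show ?thesis
          by (simp add: Int_def conj_commute)
      qed
      also have "\<dots> = \<theta> * (fact (n - 1) / fact (p - 1)) * (pochhammer \<theta> (p - 1) / pochhammer \<theta> n)"
        using p by (subst prob_feller_measure_Collect[OF \<theta>]) (auto simp: last_block_prob[OF \<theta>])
      finally have A: "(\<integral>\<xi>. ?A p \<xi> \<partial>feller_measure \<theta>) =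
          \<theta> * (fact (n - 1) / fact (p - 1)) * (pochhammer \<theta> (p - 1) / pochhammer \<theta> n)" .
      have "(\<integral>\<xi>. ?A p \<xi> * \<phi> (add (n - p + 1) (feller (p - 1) \<xi>)) \<partial>feller_measure \<theta>) =
          (\<integral>\<xi>. ?A p \<xi> \<partial>feller_measure \<theta>) *
          (\<integral>\<xi>. \<phi> (add (n - p + 1) (feller (p - 1) \<xi>)) \<partial>feller_measure \<theta>)"
        using p by (intro depends_on_integral_mult[OF depA depG]) auto
      also have "(\<integral>\<xi>. \<phi> (add (n - p + 1) (feller (p - 1) \<xi>)) \<partial>feller_measure \<theta>) =
          fact (p - 1) / pochhammer \<theta> (p - 1) *
          (\<Sum>\<beta>\<in>partitions (p - 1). \<phi> (add (n - p + 1) \<beta>) * ewens_weight \<theta> (p - 1) \<beta>)"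
        using p by (intro less.IH) auto
      finally show "(\<integral>\<xi>. ?A p \<xi> * \<phi> (add (n - p + 1) (feller (p - 1) \<xi>)) \<partial>feller_measure \<theta>) =
          C * (\<Sum>\<beta>\<in>partitions (p - 1). \<phi> (add (n - p + 1) \<beta>) * ewens_weight \<theta> (p - 1) \<beta>)"
        using pochhammer_pos[OF \<theta>, of "p - 1"] unfolding A C_def by simp
    qed
    \<comment> \<open>The sum is reindexed by the size j = n - p + 1 of the removed part.\<close>
    also have "\<dots> = (\<Sum>j=1..n. C *
        (\<Sum>\<beta>\<in>partitions (n - j). \<phi> (add j \<beta>) * ewens_weight \<theta> (n - j) \<beta>))"
      by (rule sum.reindex_bij_witness[where i = "\<lambda>j. n - j + 1" and j = "\<lambda>p. n - p + 1"]) auto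
    also have "\<dots> = (\<Sum>j=1..n. fact (n - 1) / pochhammer \<theta> n *
        (\<Sum>\<alpha>\<in>partitions n. \<phi> \<alpha> * (real (j * \<alpha> j) * ewens_weight \<theta> n \<alpha>)))"
    proof (rule sum.cong[OF refl])
      fix j assume "j \<in> {1..n}"
      then have "(\<Sum>\<alpha>\<in>partitions n. \<phi> \<alpha> * (real (j * \<alpha> j) * ewens_weight \<theta> n \<alpha>)) =
          (\<Sum>\<beta>\<in>partitions (n - j). \<phi> (add j \<beta>) * (\<theta> * ewens_weight \<theta> (n - j) \<beta>))"
        unfolding add_def by (intro sum_partitions_add_part[symmetric]) auto
      also have "\<dots> = \<theta> * (\<Sum>\<beta>\<in>partitions (n - j). \<phi> (add j \<beta>) * ewens_weight \<theta> (n - j) \<beta>)"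
        by (simp add: sum_distrib_left algebra_simps)
      finally show "C * (\<Sum>\<beta>\<in>partitions (n - j). \<phi> (add j \<beta>) * ewens_weight \<theta> (n - j) \<beta>) =
          fact (n - 1) / pochhammer \<theta> n *
          (\<Sum>\<alpha>\<in>partitions n. \<phi> \<alpha> * (real (j * \<alpha> j) * ewens_weight \<theta> n \<alpha>))"
        by (simp add: C_def)
    qed
    also have "\<dots> = fact (n - 1) / pochhammer \<theta> n *
        (\<Sum>j=1..n. \<Sum>\<alpha>\<in>partitions n. \<phi> \<alpha> * (real (j * \<alpha> j) * ewens_weight \<theta> n \<alpha>))"
      by (rule sum_distrib_left[symmetric])
    also have "\<dots> = fact (n - 1) / pochhammer \<theta> n *
        (\<Sum>\<alpha>\<in>partitions n. \<Sum>j=1..n. \<phi> \<alpha> * (real (j * \<alpha> j) * ewens_weight \<theta> n \<alpha>))"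
      by (rule arg_cong[OF sum.swap])
    also have "\<dots> = fact (n - 1) / pochhammer \<theta> n *
        (\<Sum>\<alpha>\<in>partitions n. \<phi> \<alpha> * (real n * ewens_weight \<theta> n \<alpha>))"
    proof (intro arg_cong2[of _ _ _ _ "(*)"] sum.cong refl)
      fix \<alpha> assume "\<alpha> \<in> partitions n"
      then have "(\<Sum>j=1..n. j * \<alpha> j) = n"
        by (simp add: partitions_def)
      then have "real n = (\<Sum>j=1..n. real (j * \<alpha> j))"
        by (metis of_nat_sum)
      then show "(\<Sum>j=1..n. \<phi> \<alpha> * (real (j * \<alpha> j) * ewens_weight \<theta> n \<alpha>)) =
          \<phi> \<alpha> * (real n * ewens_weight \<theta> n \<alpha>)"
        by (simp add: sum_distrib_left sum_distrib_right del: of_nat_mult)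
    qed
    also have "\<dots> = fact n / pochhammer \<theta> n * (\<Sum>\<alpha>\<in>partitions n. \<phi> \<alpha> * ewens_weight \<theta> n \<alpha>)"
      using n by (simp add: fact_reduce[of n] sum_distrib_left sum_divide_distrib algebra_simps)
    finally show ?thesis .
  qed
qed

subsection \<open>Reduction to Lipschitz test functions\<close>

text \<open>Each \<open>g k\<close> is an infimum of k-Lipschitz functions of x, and the choice y =
  x gives the bound by f. For convergence, continuity handles the points y near x and the distance
  penalty handles the far ones.\<close>

lemma lipschitz_approximation_below:
  fixes f :: "'x::metric_space \<Rightarrow> real"
  assumes cont: "continuous_on UNIV f" and bound: "\<And>x. \<bar>f x\<bar> \<le> B"
  defines "g \<equiv> \<lambda>k::nat. \<lambda>x. INF y. f y + real k * dist x y"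
  shows "(real k)-lipschitz_on UNIV (g k)" "\<bar>g k x\<bar> \<le> B" "g k x \<le> f x"
    "(\<lambda>k. g k x) \<longlonglongrightarrow> f x"
proof -
  have lower: "- B \<le> f y + real k * dist x y" for k x y
    using bound[of y] by (smt (verit) mult_nonneg_nonneg of_nat_0_le_iff zero_le_dist)
  then have bdd: "bdd_below (range (\<lambda>y. f y + real k * dist x y))" for k x
    by (intro bdd_belowI[of _ "- B"]) auto
  have le: "g k x \<le> f y + real k * dist x y" for k x y
    unfolding g_def by (rule cINF_lower[OF bdd]) simp
  show le_f: "g k x \<le> f x" for k x
    using le[of k x x] by simp
  show "\<bar>g k x\<bar> \<le> B" for k x
  proof -
    have "- B \<le> g k x"
      unfolding g_def by (rule cINF_greatest) (auto intro: lower)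
    then show ?thesis using le_f[of k x] bound[of x] by simp
  qed
  have one_sided: "g k x - real k * dist x y \<le> g k y" for k x y
  proof -
    have "g k x - real k * dist x y \<le> f z + real k * dist y z" for z
    proof -
      have "real k * dist x z \<le> real k * (dist x y + dist y z)"
        by (intro mult_left_mono dist_triangle) simp
      then show ?thesis using le[of k x z] by (simp add: algebra_simps)
    qed
    then have "g k x - real k * dist x y \<le> (INF z. f z + real k * dist y z)"
      by (intro cINF_greatest) auto
    then show ?thesis
      by (simp only: g_def)
  qed
  show "(real k)-lipschitz_on UNIV (g k)" for k
  proof (rule lipschitz_onI)
    fix x y
    show "dist (g k x) (g k y) \<le> real k * dist x y"
      using one_sided[of k x y] one_sided[of k y x] by (simp add: dist_real_def dist_commute)
  qed simp
  show "(\<lambda>k. g k x) \<longlonglongrightarrow> f x" for x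
  proof (rule LIMSEQ_I)
    fix r :: real assume r: "r > 0"
    have "isCont f x"
      using cont by (simp add: continuous_on_eq_continuous_at)
    then obtain d where d: "d > 0" "\<And>y. dist y x < d \<Longrightarrow> dist (f y) (f x) < r / 2"
      using r unfolding continuous_at_eps_delta by (meson half_gt_zero)
    \<comment> \<open>For k \<ge> K and dist x y \<ge> d the penalty exceeds 2 * B, an upper bound
      for f x - f y.\<close>
    obtain K :: nat where K: "2 * B / d < real K"
      using reals_Archimedean2 by blast
    have "norm (g k x - f x) < r" if "k \<ge> K" for k
    proof -
      have "f x - r / 2 \<le> f y + real k * dist x y" for y
      proof (cases "dist y x < d")
        case True
        have "0 \<le> real k * dist x y" by simp
        then show ?thesis using d(2)[OF True] unfolding dist_real_def by linarith
      next
        case False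
        have "2 * B < real K * d" using K d(1) by (simp add: field_simps)
        also have "\<dots> \<le> real k * dist x y"
          using False that d(1) by (intro mult_mono) (auto simp: dist_commute)
        finally show ?thesis using bound[of x] bound[of y] r by linarith
      qed
      then have "f x - r / 2 \<le> g k x"
        unfolding g_def by (intro cINF_greatest) auto
      then show ?thesis using le_f[of k x] r by simp
    qed
    then show "\<exists>K. \<forall>k\<ge>K. norm (g k x - f x) < r" by blast
  qed
qed

text \<open>Lipschitz approximation from below bounds the limit inferior of the expectations; the
  same bound for the negated test function controls the limit superior.\<close>

lemma converges_in_distribution_lipschitzI:
  fixes X :: "nat \<Rightarrow> 'a \<Rightarrow> 'x::metric_space"
  assumes M: "\<And>n. n \<ge> 1 \<Longrightarrow> prob_space (M n)" "\<And>n. n \<ge> 1 \<Longrightarrow> X n \<in> borel_measurable (M n)"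
    and N: "prob_space N" "Y \<in> borel_measurable N"
    and lip: "\<And>f :: 'x \<Rightarrow> real. \<And>L B. L-lipschitz_on UNIV f \<Longrightarrow> (\<And>x. \<bar>f x\<bar> \<le> B) \<Longrightarrow>
      (\<lambda>n. \<integral>\<omega>. f (X n \<omega>) \<partial>M n) \<longlonglongrightarrow> (\<integral>\<omega>. f (Y \<omega>) \<partial>N)"
  shows "converges_in_distribution M X N Y"
  unfolding converges_in_distribution_def
proof (intro allI impI)
  fix f :: "'x \<Rightarrow> real"
  assume f: "continuous_on UNIV f" "bounded (range f)"
  interpret N: prob_space N by fact
  have lower: "\<exists>n0. \<forall>n\<ge>n0. (\<integral>\<omega>. h (X n \<omega>) \<partial>M n) > (\<integral>\<omega>. h (Y \<omega>) \<partial>N) - e"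
    if h: "continuous_on UNIV h" "bounded (range h)" and e: "e > 0" for h :: "'x \<Rightarrow> real" and e :: real
  proof -
    obtain B where B: "\<And>x. \<bar>h x\<bar> \<le> B"
      using h(2) unfolding bounded_iff by auto
    define g where "g k x = (INF y. h y + real k * dist x y)" for k :: nat and x
    note g = lipschitz_approximation_below[OF h(1) B, folded g_def]
    have contg: "continuous_on UNIV (g k)" for k
      using g(1) by (rule lipschitz_on_continuous_on)
    have hm: "h \<in> borel_measurable borel" and gm: "g k \<in> borel_measurable borel" for k
      using h(1) contg by (auto intro: borel_measurable_continuous_onI)
    \<comment> \<open>Dominated convergence takes place under the fixed measure \<open>N\<close>;
      under \<open>M n\<close> the inequality g k \<le> h suffices, so k can be fixed before n
      grows.\<close>
    have "(\<lambda>k. \<integral>\<omega>. g k (Y \<omega>) \<partial>N) \<longlonglongrightarrow> (\<integral>\<omega>. h (Y \<omega>) \<partial>N)"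
      by (rule integral_dominated_convergence[where w = "\<lambda>_. B"])
        (use g N(2) hm gm in \<open>auto intro: measurable_compose\<close>)
    from LIMSEQ_D[OF this, of "e / 2"] e
    obtain k where k: "\<bar>(\<integral>\<omega>. g k (Y \<omega>) \<partial>N) - (\<integral>\<omega>. h (Y \<omega>) \<partial>N)\<bar> < e / 2"
      by auto
    have "(\<lambda>n. \<integral>\<omega>. g k (X n \<omega>) \<partial>M n) \<longlonglongrightarrow> (\<integral>\<omega>. g k (Y \<omega>) \<partial>N)"
      using g(1,2) by (rule lip)
    from LIMSEQ_D[OF this, of "e / 2"] e
    obtain n1 where n1: "\<And>n. n \<ge> n1 \<Longrightarrow>
        \<bar>(\<integral>\<omega>. g k (X n \<omega>) \<partial>M n) - (\<integral>\<omega>. g k (Y \<omega>) \<partial>N)\<bar> < e / 2"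
      by auto
    have "(\<integral>\<omega>. h (X n \<omega>) \<partial>M n) > (\<integral>\<omega>. h (Y \<omega>) \<partial>N) - e" if n: "n \<ge> max 1 n1" for n
    proof -
      interpret prob_space "M n" using M(1) n by simp
      have X: "X n \<in> borel_measurable (M n)" using M(2) n by simp
      have "(\<integral>\<omega>. g k (X n \<omega>) \<partial>M n) \<le> (\<integral>\<omega>. h (X n \<omega>) \<partial>M n)"
        by (intro integral_mono integrable_const_bound[where B = B])
          (use g B X hm gm in \<open>auto intro: measurable_compose\<close>)
      then show ?thesis using k n1[of n] n by linarith
    qed
    then show ?thesis by blast
  qed
  show "(\<lambda>n. \<integral>\<omega>. f (X n \<omega>) \<partial>M n) \<longlonglongrightarrow> (\<integral>\<omega>. f (Y \<omega>) \<partial>N)"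
  proof (rule LIMSEQ_I)
    fix e :: real assume e: "e > 0"
    obtain n1 where n1: "\<And>n. n \<ge> n1 \<Longrightarrow> (\<integral>\<omega>. f (X n \<omega>) \<partial>M n) > (\<integral>\<omega>. f (Y \<omega>) \<partial>N) - e"
      using lower[OF f e] by blast
    have "continuous_on UNIV (\<lambda>x. - f x)" "bounded (range (\<lambda>x. - f x))"
      using f by (auto intro: continuous_on_minus simp: bounded_iff)
    from lower[OF this e] obtain n2 where
      "\<And>n. n \<ge> n2 \<Longrightarrow> (\<integral>\<omega>. - f (X n \<omega>) \<partial>M n) > (\<integral>\<omega>. - f (Y \<omega>) \<partial>N) - e"
      by blast
    then have n2: "\<And>n. n \<ge> n2 \<Longrightarrow> (\<integral>\<omega>. f (X n \<omega>) \<partial>M n) < (\<integral>\<omega>. f (Y \<omega>) \<partial>N) + e"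
      by fastforce
    have "norm ((\<integral>\<omega>. f (X n \<omega>) \<partial>M n) - (\<integral>\<omega>. f (Y \<omega>) \<partial>N)) < e" if "n \<ge> max n1 n2" for n
      using n1[of n] n2[of n] that by (simp add: abs_less_iff)
    then show "\<exists>no. \<forall>n\<ge>no. norm ((\<integral>\<omega>. f (X n \<omega>) \<partial>M n) - (\<integral>\<omega>. f (Y \<omega>) \<partial>N)) < e"
      by blast
  qed
qed

subsection \<open>Convergence under perturbed Ewens measures\<close>

lemma ewens_weight_nonneg: "\<theta> > 0 \<Longrightarrow> 0 \<le> ewens_weight \<theta> n \<alpha>"
  unfolding ewens_weight_def by (intro prod_nonneg) simp

text \<open>Both sides reduce to the sum in \<open>integral_feller\<close>. As \<phi> is arbitrary,
  this identifies the law of \<open>feller n\<close> as the Ewens measure.\<close>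

lemma integral_ewens:
  fixes \<phi> :: "(nat \<Rightarrow> nat) \<Rightarrow> real"
  assumes "\<theta> > 0"
  shows "(\<integral>\<alpha>. \<phi> \<alpha> \<partial>ewens \<theta> n) = (\<integral>\<xi>. \<phi> (feller n \<xi>) \<partial>feller_measure \<theta>)"
proof -
  have "(\<integral>\<alpha>. \<phi> \<alpha> \<partial>ewens \<theta> n) =
      (\<Sum>\<alpha>\<in>partitions n. fact n / pochhammer \<theta> n * ewens_weight \<theta> n \<alpha> * \<phi> \<alpha>)"
    unfolding ewens_def
    by (subst lebesgue_integral_point_measure_finite)
      (use assms in \<open>auto simp: finite_partitions ewens_weight_nonneg pochhammer_pos less_imp_le\<close>)
  then show ?thesis
    unfolding integral_feller[OF assms] by (simp add: sum_distrib_left algebra_simps)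
qed

context
  fixes \<theta> :: real and \<eta> :: "(nat \<Rightarrow> nat) \<Rightarrow> real" and n :: nat
  assumes \<theta>: "\<theta> > 0" and \<eta>: "\<And>\<alpha>. \<alpha> \<in> partitions n \<Longrightarrow> 0 \<le> \<eta> \<alpha>"
    and norm_pos: "0 < ewens_norm \<theta> \<eta> n"
begin

lemma prob_space_perturbed_ewens: "prob_space (perturbed_ewens \<theta> \<eta> n)"
proof
  have "emeasure (perturbed_ewens \<theta> \<eta> n) (space (perturbed_ewens \<theta> \<eta> n)) =
      (\<Sum>\<alpha>\<in>partitions n. ennreal (\<eta> \<alpha> / ewens_norm \<theta> \<eta> n * ewens_weight \<theta> n \<alpha>))"
    unfolding perturbed_ewens_def
    by (simp add: space_point_measure emeasure_point_measure_finite finite_partitions)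
  also have "\<dots> = ennreal (\<Sum>\<alpha>\<in>partitions n. \<eta> \<alpha> / ewens_norm \<theta> \<eta> n * ewens_weight \<theta> n \<alpha>)"
    using \<eta> norm_pos ewens_weight_nonneg[OF \<theta>] by (intro sum_ennreal) (simp add: less_imp_le)
  also have "(\<Sum>\<alpha>\<in>partitions n. \<eta> \<alpha> / ewens_norm \<theta> \<eta> n * ewens_weight \<theta> n \<alpha>) =
      (\<Sum>\<alpha>\<in>partitions n. \<eta> \<alpha> * ewens_weight \<theta> n \<alpha>) / ewens_norm \<theta> \<eta> n"
    by (simp add: sum_divide_distrib)
  also have "\<dots> = 1"
    using norm_pos by (simp add: ewens_norm_def)
  finally show "emeasure (perturbed_ewens \<theta> \<eta> n) (space (perturbed_ewens \<theta> \<eta> n)) = 1"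
    by simp
qed

text \<open>Both expectations over the Feller coupling carry the constant n! /
  \<open>pochhammer \<theta> n\<close>; it cancels in the quotient and leaves
  \<open>ewens_norm\<close> as the normaliser.\<close>

lemma integral_perturbed_ewens:
  fixes \<phi> :: "(nat \<Rightarrow> nat) \<Rightarrow> real"
  shows "(\<integral>\<alpha>. \<phi> \<alpha> \<partial>perturbed_ewens \<theta> \<eta> n) =
    (\<integral>\<xi>. \<eta> (feller n \<xi>) * \<phi> (feller n \<xi>) \<partial>feller_measure \<theta>) /
    (\<integral>\<xi>. \<eta> (feller n \<xi>) \<partial>feller_measure \<theta>)"
proof -
  have "(\<integral>\<alpha>. \<phi> \<alpha> \<partial>perturbed_ewens \<theta> \<eta> n) =
      (\<Sum>\<alpha>\<in>partitions n. \<eta> \<alpha> / ewens_norm \<theta> \<eta> n * ewens_weight \<theta> n \<alpha> * \<phi> \<alpha>)"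
    unfolding perturbed_ewens_def
    by (subst lebesgue_integral_point_measure_finite)
      (use \<eta> norm_pos ewens_weight_nonneg[OF \<theta>] in \<open>auto simp: finite_partitions less_imp_le\<close>)
  also have "\<dots> = (\<Sum>\<alpha>\<in>partitions n. \<eta> \<alpha> * \<phi> \<alpha> * ewens_weight \<theta> n \<alpha>) / ewens_norm \<theta> \<eta> n"
    by (simp add: sum_divide_distrib algebra_simps)
  finally show ?thesis
    using pochhammer_pos[OF \<theta>, of n]
      integral_feller[OF \<theta>, of "\<lambda>\<alpha>. \<eta> \<alpha> * \<phi> \<alpha>" n] integral_feller[OF \<theta>, of \<eta> n]
    by (simp add: ewens_norm_def)
qed

end

section \<open>Asymptotic factorisation under the Feller coupling\<close>

lemma truncate_feller: "truncate n (feller n \<xi>) = feller n \<xi>"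
  by (auto simp: truncate_def feller_def fun_eq_iff)

text \<open>Members of \<open>binary_strings\<close> are extensional on 1..n, so a full sequence is
  first restricted; by \<open>depends_on_feller\<close> neither partition changes.\<close>

lemma norm_replace_initial_le_Max:
  fixes X :: "(nat \<Rightarrow> nat) \<Rightarrow> 'x::real_normed_vector"
  assumes "\<xi> 1" "n \<ge> 1"
  shows "norm (X (feller n \<xi>) - X (feller n (\<lambda>i. if i \<le> d then True else \<xi> i))) \<le>
    Max ((\<lambda>\<xi>. norm (X (feller n \<xi>) - X (feller n (\<lambda>i. if i \<le> d then True else \<xi> i))))
      ` binary_strings n)"
proof (rule Max_ge)
  have "finite ({1..n} \<rightarrow>\<^sub>E (UNIV :: bool set))"
    by (intro finite_PiE) auto
  then show "finite ((\<lambda>\<xi>. norm (X (feller n \<xi>) - X (feller n (\<lambda>i. if i \<le> d then True else \<xi> i))))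
      ` binary_strings n)"
    unfolding binary_strings_def by (intro finite_imageI) (auto elim: finite_subset[rotated])
  let ?r = "restrict \<xi> {1..n}"
  have eq: "feller n \<xi> = feller n ?r"
    "feller n (\<lambda>i. if i \<le> d then True else \<xi> i) = feller n (\<lambda>i. if i \<le> d then True else ?r i)"
    by (auto intro: depends_onD[OF depends_on_feller])
  have "?r \<in> binary_strings n"
    using assms by (auto simp: binary_strings_def)
  then show "norm (X (feller n \<xi>) - X (feller n (\<lambda>i. if i \<le> d then True else \<xi> i))) \<in>
      (\<lambda>\<xi>. norm (X (feller n \<xi>) - X (feller n (\<lambda>i. if i \<le> d then True else \<xi> i))))
      ` binary_strings n"
    by (rule image_eqI[rotated]) (simp only: eq)
qed

text \<open>Hoelder's inequality between L1 and L-infinity. An almost sure bound on G is allowed for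
  the sake of differences controlled only where \<xi> 1 holds.\<close>

lemma integral_mult_bounded:
  fixes F G :: "'a \<Rightarrow> real"
  assumes F: "integrable M F" and G: "G \<in> borel_measurable M" and bound: "AE x in M. \<bar>G x\<bar> \<le> K"
  shows "integrable M (\<lambda>x. F x * G x)"
    and "\<bar>\<integral>x. F x * G x \<partial>M\<bar> \<le> K * (\<integral>x. \<bar>F x\<bar> \<partial>M)"
proof -
  have AE: "AE x in M. \<bar>F x * G x\<bar> \<le> K * \<bar>F x\<bar>"
    using bound by eventually_elim (auto simp: abs_mult mult.commute[of K] intro: mult_left_mono)
  show int: "integrable M (\<lambda>x. F x * G x)"
    by (rule Bochner_Integration.integrable_bound[where f = "\<lambda>x. K * \<bar>F x\<bar>"])
      (use F G AE in auto)
  have "\<bar>\<integral>x. F x * G x \<partial>M\<bar> \<le> (\<integral>x. \<bar>F x * G x\<bar> \<partial>M)"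
    by (rule integral_abs_bound)
  also have "\<dots> \<le> (\<integral>x. K * \<bar>F x\<bar> \<partial>M)"
    by (rule integral_mono_AE) (use F int AE in auto)
  finally show "\<bar>\<integral>x. F x * G x \<partial>M\<bar> \<le> K * (\<integral>x. \<bar>F x\<bar> \<partial>M)"
    by simp
qed

lemma integral_weighted_limit:
  fixes X :: "nat \<Rightarrow> (nat \<Rightarrow> nat) \<Rightarrow> 'x::real_normed_vector" and f :: "'x \<Rightarrow> real"
  assumes \<theta>: "\<theta> > 0"
    and osc: "\<And>d::nat. (\<lambda>n. Max ((\<lambda>\<xi>. norm (X n (feller n \<xi>)
            - X n (feller n (\<lambda>i. if i \<le> d then True else \<xi> i)))) ` binary_strings n)) \<longlonglongrightarrow> 0"
    and lip: "L-lipschitz_on UNIV f" and bound: "\<And>x. \<bar>f x\<bar> \<le> B"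
    and limX: "(\<lambda>n. \<integral>\<xi>. f (X n (feller n \<xi>)) \<partial>feller_measure \<theta>) \<longlonglongrightarrow> c"
    and lim\<eta>: "L1_limit (feller_measure \<theta>) (\<lambda>n \<xi>. \<eta> (feller n \<xi>)) \<eta>_inf"
  shows "(\<lambda>n. \<integral>\<xi>. \<eta> (feller n \<xi>) * f (X n (feller n \<xi>)) \<partial>feller_measure \<theta>)
    \<longlonglongrightarrow> (\<integral>\<xi>. \<eta>_inf \<xi> \<partial>feller_measure \<theta>) * c"
proof -
  interpret prob_space "feller_measure \<theta>" by (rule prob_space_feller_measure)
  define E where "E = (\<lambda>F. \<integral>\<xi>. F \<xi> \<partial>feller_measure \<theta> :: real)"
  define \<delta> where "\<delta> n = E (\<lambda>\<xi>. \<bar>\<eta> (feller n \<xi>) - \<eta>_inf \<xi>\<bar>)" for n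
  define W where "W n \<xi> = f (X n (feller n \<xi>))" for n \<xi>
  \<comment> \<open>\<open>V d\<close> forgets the first d bits by setting them to 1; it depends on
    d+1..n alone and is thus independent of \<open>\<eta> (feller d \<xi>)\<close>.\<close>
  define V where "V d n \<xi> = f (X n (feller n (\<lambda>i. if i \<le> d then True else \<xi> i)))" for d n \<xi>
  define m where "m d n = Max ((\<lambda>\<xi>. norm (X n (feller n \<xi>)
            - X n (feller n (\<lambda>i. if i \<le> d then True else \<xi> i)))) ` binary_strings n)" for d n
  have int_inf [simp]: "integrable (feller_measure \<theta>) \<eta>_inf"
    and \<delta>_lim: "\<delta> \<longlonglongrightarrow> 0"
    using lim\<eta> by (auto simp: L1_limit_def \<delta>_def[abs_def] E_def)
  have dep\<eta>: "depends_on {1..n} (\<lambda>\<xi>. \<eta> (feller n \<xi>))" for n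
    by (rule depends_on_compose[OF depends_on_feller])
  have depW: "depends_on {1..n} (W n)" for n
    unfolding W_def by (rule depends_on_compose[OF depends_on_feller])
  have depV: "depends_on {d+1..n} (V d n)" for d n
    unfolding V_def depends_on_def
  proof (intro allI impI)
    fix \<xi> \<xi>' :: "nat \<Rightarrow> bool" assume "\<forall>i\<in>{d+1..n}. \<xi> i = \<xi>' i"
    then have "feller n (\<lambda>i. if i \<le> d then True else \<xi> i) = feller n (\<lambda>i. if i \<le> d then True else \<xi>' i)"
      by (intro depends_onD[OF depends_on_feller]) auto
    then show "f (X n (feller n (\<lambda>i. if i \<le> d then True else \<xi> i))) =
        f (X n (feller n (\<lambda>i. if i \<le> d then True else \<xi>' i)))"
      by simp
  qed
  have int\<eta> [simp]: "integrable (feller_measure \<theta>) (\<lambda>\<xi>. \<eta> (feller n \<xi>))" for n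
    by (rule depends_on_integrable[OF dep\<eta>]) auto
  have intW [simp]: "integrable (feller_measure \<theta>) (W n)" for n
    by (rule depends_on_integrable[OF depW]) auto
  have intV [simp]: "integrable (feller_measure \<theta>) (V d n)" for d n
    by (rule depends_on_integrable[OF depV]) auto
  note borel = depends_on_borel_measurable[OF dep\<eta>] depends_on_borel_measurable[OF depW]
    depends_on_borel_measurable[OF depV]
  have meas [measurable]: "(\<lambda>\<xi>. \<eta> (feller n \<xi>)) \<in> borel_measurable (feller_measure \<theta>)"
    "W n \<in> borel_measurable (feller_measure \<theta>)"
    "V d n \<in> borel_measurable (feller_measure \<theta>)" for d n
    by (auto intro!: borel)
  have bW: "\<bar>W n \<xi>\<bar> \<le> B" and bV: "\<bar>V d n \<xi>\<bar> \<le> B" for d n \<xi>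
    using bound by (auto simp: W_def V_def)
  have int\<eta>W [simp]: "integrable (feller_measure \<theta>) (\<lambda>\<xi>. \<eta> (feller k \<xi>) * W n \<xi>)" for k n
    by (rule integral_mult_bounded(1)[where K = B]) (auto simp: bW)
  have int\<eta>V [simp]: "integrable (feller_measure \<theta>) (\<lambda>\<xi>. \<eta> (feller k \<xi>) * V d n \<xi>)" for k d n
    by (rule integral_mult_bounded(1)[where K = B]) (auto simp: bV)
  have WV: "AE \<xi> in feller_measure \<theta>. \<bar>W n \<xi> - V d n \<xi>\<bar> \<le> L * m d n" if "n \<ge> 1" for d n
    using AE_feller_measure_first[OF \<theta>]
  proof eventually_elim
    case (elim \<xi>)
    have "\<bar>W n \<xi> - V d n \<xi>\<bar> \<le> L * norm (X n (feller n \<xi>)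
        - X n (feller n (\<lambda>i. if i \<le> d then True else \<xi> i)))"
      using lipschitz_onD[OF lip] by (simp add: W_def V_def dist_norm)
    also have "\<dots> \<le> L * m d n"
      unfolding m_def using elim that lipschitz_on_nonneg[OF lip]
      by (intro mult_left_mono norm_replace_initial_le_Max) auto
    finally show ?case .
  qed
  have E\<eta>: "\<bar>E (\<lambda>\<xi>. \<eta> (feller d \<xi>)) - E \<eta>_inf\<bar> \<le> \<delta> d" for d
  proof -
    have "E (\<lambda>\<xi>. \<eta> (feller d \<xi>)) - E \<eta>_inf = E (\<lambda>\<xi>. \<eta> (feller d \<xi>) - \<eta>_inf \<xi>)"
      unfolding E_def by simp
    then show ?thesis
      unfolding E_def \<delta>_def by (simp only: integral_abs_bound)
  qed
  \<comment> \<open>Every factor multiplied by \<open>A d\<close> below tends to 0 as n grows with d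
    fixed.\<close>
  define A where "A d = E (\<lambda>\<xi>. \<bar>\<eta> (feller d \<xi>)\<bar>)" for d
  have A: "\<bar>E (\<lambda>\<xi>. \<eta> (feller d \<xi>))\<bar> \<le> A d" for d
    unfolding E_def A_def by (rule integral_abs_bound)
  \<comment> \<open>Replace \<eta> at n by \<eta> at d, then W by V, factorise, and return from V to
    W, from W to c and from \<eta> at d to its limit; the summands bound these replacements in
    order.\<close>
  have estimate: "\<bar>E (\<lambda>\<xi>. \<eta> (feller n \<xi>) * W n \<xi>) - E \<eta>_inf * c\<bar> \<le>
      B * (\<delta> n + \<delta> d) + L * m d n * A d + A d * (L * m d n) + A d * \<bar>E (W n) - c\<bar> + \<delta> d * \<bar>c\<bar>"
    if n: "n \<ge> 1" for n d
  proof -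
    have "\<bar>E (\<lambda>\<xi>. \<eta> (feller n \<xi>) * W n \<xi>) - E (\<lambda>\<xi>. \<eta> (feller d \<xi>) * W n \<xi>)\<bar> =
        \<bar>E (\<lambda>\<xi>. (\<eta> (feller n \<xi>) - \<eta> (feller d \<xi>)) * W n \<xi>)\<bar>"
      unfolding E_def by (simp add: left_diff_distrib)
    also have "\<dots> \<le> B * E (\<lambda>\<xi>. \<bar>\<eta> (feller n \<xi>) - \<eta> (feller d \<xi>)\<bar>)"
      unfolding E_def by (rule integral_mult_bounded(2)) (auto simp: bW)
    also have "\<dots> \<le> B * (\<delta> n + \<delta> d)"
    proof (rule mult_left_mono)
      have "E (\<lambda>\<xi>. \<bar>\<eta> (feller n \<xi>) - \<eta> (feller d \<xi>)\<bar>) \<le>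
          E (\<lambda>\<xi>. \<bar>\<eta> (feller n \<xi>) - \<eta>_inf \<xi>\<bar> + \<bar>\<eta> (feller d \<xi>) - \<eta>_inf \<xi>\<bar>)"
        unfolding E_def by (rule integral_mono) auto
      then show "E (\<lambda>\<xi>. \<bar>\<eta> (feller n \<xi>) - \<eta> (feller d \<xi>)\<bar>) \<le> \<delta> n + \<delta> d"
        unfolding E_def \<delta>_def by simp
    \<comment> \<open>Any point of the space witnesses B \<ge> 0.\<close>
    qed (use bound[of undefined] in linarith)
    finally have 1: "\<bar>E (\<lambda>\<xi>. \<eta> (feller n \<xi>) * W n \<xi>) - E (\<lambda>\<xi>. \<eta> (feller d \<xi>) * W n \<xi>)\<bar>
        \<le> B * (\<delta> n + \<delta> d)" .
    have "\<bar>E (\<lambda>\<xi>. \<eta> (feller d \<xi>) * W n \<xi>) - E (\<lambda>\<xi>. \<eta> (feller d \<xi>) * V d n \<xi>)\<bar> =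
        \<bar>E (\<lambda>\<xi>. \<eta> (feller d \<xi>) * (W n \<xi> - V d n \<xi>))\<bar>"
      unfolding E_def by (simp add: right_diff_distrib)
    also have "\<dots> \<le> L * m d n * A d"
      unfolding E_def A_def by (rule integral_mult_bounded(2)) (auto intro: WV n)
    finally have 2: "\<bar>E (\<lambda>\<xi>. \<eta> (feller d \<xi>) * W n \<xi>) - E (\<lambda>\<xi>. \<eta> (feller d \<xi>) * V d n \<xi>)\<bar>
        \<le> L * m d n * A d" .
    have 3: "E (\<lambda>\<xi>. \<eta> (feller d \<xi>) * V d n \<xi>) = E (\<lambda>\<xi>. \<eta> (feller d \<xi>)) * E (V d n)"
      unfolding E_def by (rule depends_on_integral_mult[OF dep\<eta> depV]) auto
    \<comment> \<open>The factor 1 makes this an instance of the Hoelder bound, with total mass 1 on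
      the right.\<close>
    have "\<bar>E (\<lambda>\<xi>. 1 * (W n \<xi> - V d n \<xi>))\<bar> \<le> L * m d n * E (\<lambda>\<xi>. \<bar>1\<bar>)"
      unfolding E_def by (rule integral_mult_bounded(2)) (auto intro: WV n)
    then have "\<bar>E (V d n) - E (W n)\<bar> \<le> L * m d n"
      unfolding E_def by (simp add: prob_space abs_minus_commute)
    then have 4: "\<bar>E (\<lambda>\<xi>. \<eta> (feller d \<xi>)) * (E (V d n) - E (W n))\<bar> \<le> A d * (L * m d n)"
      unfolding abs_mult using A[of d] by (intro mult_mono) auto
    have 5: "\<bar>E (\<lambda>\<xi>. \<eta> (feller d \<xi>)) * (E (W n) - c)\<bar> \<le> A d * \<bar>E (W n) - c\<bar>"
      unfolding abs_mult using A[of d] by (intro mult_right_mono) auto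
    have 6: "\<bar>(E (\<lambda>\<xi>. \<eta> (feller d \<xi>)) - E \<eta>_inf) * c\<bar> \<le> \<delta> d * \<bar>c\<bar>"
      unfolding abs_mult using E\<eta>[of d] by (intro mult_right_mono) auto
    have "E (\<lambda>\<xi>. \<eta> (feller n \<xi>) * W n \<xi>) - E \<eta>_inf * c =
        (E (\<lambda>\<xi>. \<eta> (feller n \<xi>) * W n \<xi>) - E (\<lambda>\<xi>. \<eta> (feller d \<xi>) * W n \<xi>)) +
        (E (\<lambda>\<xi>. \<eta> (feller d \<xi>) * W n \<xi>) - E (\<lambda>\<xi>. \<eta> (feller d \<xi>) * V d n \<xi>)) +
        E (\<lambda>\<xi>. \<eta> (feller d \<xi>)) * (E (V d n) - E (W n)) +
        E (\<lambda>\<xi>. \<eta> (feller d \<xi>)) * (E (W n) - c) +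
        (E (\<lambda>\<xi>. \<eta> (feller d \<xi>)) - E \<eta>_inf) * c"
      unfolding 3 by (simp add: algebra_simps)
    then show ?thesis
      using 1 2 4 5 6 by linarith
  qed
  have "(\<lambda>n. E (\<lambda>\<xi>. \<eta> (feller n \<xi>) * W n \<xi>)) \<longlonglongrightarrow> E \<eta>_inf * c"
  proof (rule tendstoI)
    fix e :: real assume e: "e > 0"
    \<comment> \<open>First d is chosen so that the part of the estimate that survives as n grows is
      below e; then n grows with d fixed.\<close>
    have "(\<lambda>d. B * \<delta> d + \<delta> d * \<bar>c\<bar>) \<longlonglongrightarrow> B * 0 + 0 * \<bar>c\<bar>"
      by (intro tendsto_intros \<delta>_lim)
    then have "\<forall>\<^sub>F d in sequentially. B * \<delta> d + \<delta> d * \<bar>c\<bar> < e"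
      using e by (intro order_tendstoD(2)) auto
    then obtain d where d: "B * \<delta> d + \<delta> d * \<bar>c\<bar> < e"
      by (auto simp: eventually_sequentially)
    have "(\<lambda>n. B * (\<delta> n + \<delta> d) + L * m d n * A d + A d * (L * m d n) + A d * \<bar>E (W n) - c\<bar> + \<delta> d * \<bar>c\<bar>)
        \<longlonglongrightarrow> B * (0 + \<delta> d) + L * 0 * A d + A d * (L * 0) + A d * \<bar>c - c\<bar> + \<delta> d * \<bar>c\<bar>"
      using osc[of d] limX unfolding m_def[symmetric] W_def[symmetric] E_def[symmetric]
      by (intro tendsto_intros \<delta>_lim) (simp_all add: E_def)
    then have "\<forall>\<^sub>F n in sequentially. B * (\<delta> n + \<delta> d) + L * m d n * A d + A d * (L * m d n)
        + A d * \<bar>E (W n) - c\<bar> + \<delta> d * \<bar>c\<bar> < e"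
      using d by (intro order_tendstoD(2)) auto
    then show "\<forall>\<^sub>F n in sequentially. dist (E (\<lambda>\<xi>. \<eta> (feller n \<xi>) * W n \<xi>)) (E \<eta>_inf * c) < e"
      using eventually_ge_at_top[of 1]
      by eventually_elim (unfold dist_real_def, rule le_less_trans[OF estimate])
  qed
  then show ?thesis
    by (simp add: E_def W_def)
qed

theorem theorem1p1:
  fixes \<theta> :: real
    and X :: "nat \<Rightarrow> (nat \<Rightarrow> nat) \<Rightarrow> 'x::real_normed_vector"
    and N :: "'b measure"
    and Y :: "'b \<Rightarrow> 'x"
    and P :: "nat \<Rightarrow> (nat \<Rightarrow> nat) measure"
  assumes "\<theta> > 0"
    and "\<And>d::nat. (\<lambda>n. Max ((\<lambda>\<xi>. norm (X n (feller n \<xi>)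
            - X n (feller n (\<lambda>i. if i \<le> d then True else \<xi> i)))) ` binary_strings n)) \<longlonglongrightarrow> 0"
    and "prob_space N"
    and "Y \<in> borel_measurable N"
    and "converges_in_distribution (ewens \<theta>) X N Y"
    and "asymptotically_ewens \<theta> P"
  shows "converges_in_distribution P X N Y"
proof -
  obtain \<eta> \<eta>_inf where \<eta>: "\<And>k \<alpha>. \<alpha> \<in> partitions k \<Longrightarrow> 0 \<le> \<eta> \<alpha>"
    and norm_pos: "\<And>n. n \<ge> 1 \<Longrightarrow> 0 < ewens_norm \<theta> \<eta> n"
    and P: "\<And>n. n \<ge> 1 \<Longrightarrow> P n = perturbed_ewens \<theta> \<eta> n"
    and lim: "L1_limit (feller_measure \<theta>) (\<lambda>n \<xi>. \<eta> (feller n \<xi>)) \<eta>_inf"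
    and pos: "0 < (\<integral>\<xi>. \<eta>_inf \<xi> \<partial>feller_measure \<theta>)"
    using assms(6) unfolding asymptotically_ewens_def truncate_feller by blast
  show ?thesis
  proof (rule converges_in_distribution_lipschitzI)
    fix n :: nat assume "n \<ge> 1"
    then show "prob_space (P n)"
      using prob_space_perturbed_ewens[OF assms(1) \<eta> norm_pos] P by simp
    \<comment> \<open>The sigma-algebra of a point measure is the full power set.\<close>
    show "X n \<in> borel_measurable (P n)"
      using P[OF \<open>n \<ge> 1\<close>] by (simp add: perturbed_ewens_def)
  next
    fix f :: "'x \<Rightarrow> real" and L B
    assume lip: "L-lipschitz_on UNIV f" and bound: "\<And>x. \<bar>f x\<bar> \<le> B"
    have "continuous_on UNIV f" "bounded (range f)"
      using lipschitz_on_continuous_on[OF lip] bound by (auto simp: bounded_iff)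
    then have "(\<lambda>n. \<integral>\<xi>. f (X n (feller n \<xi>)) \<partial>feller_measure \<theta>) \<longlonglongrightarrow> (\<integral>\<omega>. f (Y \<omega>) \<partial>N)"
      using assms(5) unfolding converges_in_distribution_def integral_ewens[OF assms(1)] by blast
    note num = integral_weighted_limit[OF assms(1,2) lip bound this lim]
    \<comment> \<open>The constant test function 1 turns the weighted limit into convergence of the
      normalisers.\<close>
    have den: "(\<lambda>n. \<integral>\<xi>. \<eta> (feller n \<xi>) \<partial>feller_measure \<theta>) \<longlonglongrightarrow> (\<integral>\<xi>. \<eta>_inf \<xi> \<partial>feller_measure \<theta>)"
      using integral_weighted_limit[where X = X and f = "\<lambda>_. 1" and c = 1 and L = 0 and B = 1,
        OF assms(1,2) lipschitz_on_constant _ _ lim]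
        prob_space.prob_space[OF prob_space_feller_measure, of \<theta>] by simp
    \<comment> \<open>Positivity of the limiting expectation of \<eta> permits the division, after
      which that expectation cancels.\<close>
    have "(\<lambda>n. (\<integral>\<xi>. \<eta> (feller n \<xi>) * f (X n (feller n \<xi>)) \<partial>feller_measure \<theta>) /
        (\<integral>\<xi>. \<eta> (feller n \<xi>) \<partial>feller_measure \<theta>)) \<longlonglongrightarrow> (\<integral>\<omega>. f (Y \<omega>) \<partial>N)"
      using tendsto_divide[OF num den] pos by simp
    \<comment> \<open>The measures \<open>P n\<close> are prescribed from n = 1 on, so the two
      sequences agree eventually.\<close>
    then show "(\<lambda>n. \<integral>\<omega>. f (X n \<omega>) \<partial>P n) \<longlonglongrightarrow> (\<integral>\<omega>. f (Y \<omega>) \<partial>N)"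
      by (rule Lim_transform_eventually)
        (use P integral_perturbed_ewens[OF assms(1) \<eta> norm_pos] in
          \<open>auto simp: eventually_sequentially intro!: exI[of _ 1]\<close>)
  qed (fact assms)+
qed

end
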